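(* Let $M$ be an object of PreCu, let $P$ be an object of Cu, and let $\alpha\colon M\to P$ be a map in PreCu. If $(N,\iota)$ is a completion of $M$, then there exists a unique map $\beta\colon N\to P$ in Cu such that $\beta\circ\iota=\alpha$. Moreover, if $\alpha$ is an order-embedding, then so is $\beta$.
   Context: All monoids are commutative, written additively with neutral element $0$, and equipped with a partial order $\le$ compatible with addition such that $x\ge 0$ for every element $x$. Maps between monoids are additive, order-preserving and preserve $0$. A monoid map $\varphi\colon M\to N$ is an order-embedding if $a\le b$ whenever $\varphi(a)\le\varphi(b)$. The supremum of an increasing sequence is its least upper bound, if it exists. For $x,y$ in a monoid $M$, write $x\ll y$ if, whenever $(y_n)$ is an increasing sequence in $M$ whose supremum exists in $M$ and $y\le\sup y_n$, then $x\le y_k$ for some $k$. A sequence $(x_n)$ is rapidly increasing if $x_n\ll x_{n+1}$ for all $n$. PreCu is the category whose objects are the monoids $M$ (commutative, written additively with neutral element $0$, and equipped with a partial order $\le$ compatible with addition such that $x\ge 0$ for every $x\in M$) such that (i) every element of $M$ is the supremum of a rapidly increasing sequence in $M$; (ii) $\ll$ and suprema are compatible with addition: $x\ll y$ and $z\ll t$ imply $x+z\ll y+t$, and if $(x_n)$, $(y_n)$ are increasing sequences with suprema $x$, $y$, then $x+y$ is the supremum of $(x_n+y_n)$. Maps in PreCu are monoid maps that preserve suprema of increasing sequences (when they exist) and preserve $\ll$. Cu is the full subcategory of PreCu consisting of the objects in which every increasing sequence has a supremum. A completion of an object $M$ of PreCu is a pair $(N,\iota)$ such that (i) $N$ is an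 object of Cu; (ii) $\iota\colon M\to N$ is an order-embedding and a map in PreCu; (iii) for every $x\in N$ there is a rapidly increasing sequence $(x_n)$ in $M$ such that $x=\sup\iota(x_n)$. *)

theory Defs
  imports Complex_Main
begin

text \<open>
  Monoids, objects of PreCu and objects of Cu are types of the classes below. Suprema need not
  exist, so they are treated as a relation between sequences and elements.
  Inside the classes, \<open>incseq X\<close> has to be spelled \<open>monotone (\<le>) (\<le>) X\<close>.
\<close>

class positive_ordered_monoid = ordered_comm_monoid_add +
  assumes zero_least: "0 \<le> x"

context order
begin

definition is_seq_sup :: "(nat \<Rightarrow> 'a) \<Rightarrow> 'a \<Rightarrow> bool" where
  "is_seq_sup X s \<longleftrightarrow> (\<forall>n. X n \<le> s) \<and> (\<forall>u. (\<forall>n. X n \<le> u) \<longrightarrow> s \<le> u)"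

definition way_below :: "'a \<Rightarrow> 'a \<Rightarrow> bool" (infix "\<lless>" 50) where
  "x \<lless> y \<longleftrightarrow> (\<forall>Y s. monotone (\<le>) (\<le>) Y \<longrightarrow> is_seq_sup Y s \<longrightarrow> y \<le> s \<longrightarrow> (\<exists>k. x \<le> Y k))"

definition rapidly_increasing :: "(nat \<Rightarrow> 'a) \<Rightarrow> bool" where
  "rapidly_increasing X \<longleftrightarrow> (\<forall>n. X n \<lless> X (Suc n))"

end

class precu = positive_ordered_monoid +
  assumes rapidly_increasing_approx: "\<exists>X. rapidly_increasing X \<and> is_seq_sup X x"
    and way_below_add: "x \<lless> y \<Longrightarrow> z \<lless> t \<Longrightarrow> x + z \<lless> y + t"
    and is_seq_sup_add:
      "monotone (\<le>) (\<le>) X \<Longrightarrow> monotone (\<le>) (\<le>) Y \<Longrightarrow>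
        is_seq_sup X x \<Longrightarrow> is_seq_sup Y y \<Longrightarrow>
        is_seq_sup (\<lambda>n. X n + Y n) (x + y)"

class cu = precu +
  assumes incseq_has_sup: "monotone (\<le>) (\<le>) X \<Longrightarrow> \<exists>s. is_seq_sup X s"

definition monoid_map :: "('a::positive_ordered_monoid \<Rightarrow> 'b::positive_ordered_monoid) \<Rightarrow> bool" where
  "monoid_map \<phi> \<longleftrightarrow> \<phi> 0 = 0 \<and> (\<forall>x y. \<phi> (x + y) = \<phi> x + \<phi> y) \<and> mono \<phi>"

definition order_embedding :: "('a::positive_ordered_monoid \<Rightarrow> 'b::positive_ordered_monoid) \<Rightarrow> bool" where
  "order_embedding \<phi> \<longleftrightarrow> monoid_map \<phi> \<and> (\<forall>a b. \<phi> a \<le> \<phi> b \<longrightarrow> a \<le> b)"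

text \<open>As Cu is a full subcategory of PreCu, this is also the notion of a map in Cu.\<close>

definition precu_map :: "('a::precu \<Rightarrow> 'b::precu) \<Rightarrow> bool" where
  "precu_map \<phi> \<longleftrightarrow> monoid_map \<phi> \<and>
    (\<forall>X s. incseq X \<longrightarrow> is_seq_sup X s \<longrightarrow> is_seq_sup (\<lambda>n. \<phi> (X n)) (\<phi> s)) \<and>
    (\<forall>x y. x \<lless> y \<longrightarrow> \<phi> x \<lless> \<phi> y)"

text \<open>
  The completion \<open>(N, \<iota>)\<close> is given by \<open>\<iota>\<close> alone: \<open>N\<close> is its codomain type, and that \<open>N\<close> is an
  object of Cu is the class constraint \<^class>\<open>cu\<close>.
\<close>

definition is_completion :: "('m::precu \<Rightarrow> 'n::cu) \<Rightarrow> bool" where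
  "is_completion \<iota> \<longleftrightarrow> order_embedding \<iota> \<and> precu_map \<iota> \<and>
    (\<forall>x. \<exists>X. rapidly_increasing X \<and> is_seq_sup (\<lambda>n. \<iota> (X n)) x)"

end

theory Submission
  imports Defs
begin

text \<open>
  Every element of \<open>N\<close> is the supremum of \<open>\<iota> \<circ> X\<close> for a rapidly increasing \<open>X\<close> in \<open>M\<close>, and a map
  preserving suprema must send it to the supremum of \<open>\<alpha> \<circ> X\<close>. This value does not depend on
  \<open>X\<close>: if the supremum of \<open>\<iota> \<circ> X\<close> is below that of \<open>\<iota> \<circ> Y\<close>, then each \<open>\<iota> (X n)\<close>, being way
  below the former, is below some \<open>\<iota> (Y k)\<close>, hence \<open>X n \<le> Y k\<close>. The same comparison with \<open>\<iota>\<close> and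
  \<open>\<alpha>\<close> exchanged shows that \<open>\<beta>\<close> reflects the order when \<open>\<alpha>\<close> does.
\<close>

lemma is_seq_sup_upper: "is_seq_sup X s \<Longrightarrow> X n \<le> s"
  by (simp add: is_seq_sup_def)

lemma is_seq_sup_least: "is_seq_sup X s \<Longrightarrow> (\<And>n. X n \<le> u) \<Longrightarrow> s \<le> u"
  by (simp add: is_seq_sup_def)

lemma is_seq_sup_unique:
  fixes s t :: "'a::order"
  shows "is_seq_sup X s \<Longrightarrow> is_seq_sup X t \<Longrightarrow> s = t"
  by (meson antisym is_seq_sup_def)

lemma way_belowD:
  fixes x y :: "'a::order"
  shows "x \<lless> y \<Longrightarrow> incseq Y \<Longrightarrow> is_seq_sup Y s \<Longrightarrow> y \<le> s \<Longrightarrow> \<exists>k. x \<le> Y k"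
  by (auto simp: way_below_def)

lemma way_below_mono:
  fixes x y :: "'a::order"
  assumes "x' \<le> x" "x \<lless> y" "y \<le> y'"
  shows "x' \<lless> y'"
  unfolding way_below_def
  by (meson assms order_trans way_belowD)

lemma way_below_imp_le:
  fixes x y :: "'a::order"
  assumes "x \<lless> y"
  shows "x \<le> y"
  \<comment> \<open>The constant sequence \<open>y\<close> is the test sequence.\<close>
  using way_belowD[OF assms, of "\<lambda>_. y" y] by (simp add: is_seq_sup_def)

lemma rapidly_increasing_imp_incseq:
  fixes X :: "nat \<Rightarrow> 'a::order"
  shows "rapidly_increasing X \<Longrightarrow> incseq X"
  by (simp add: incseq_SucI rapidly_increasing_def way_below_imp_le)

lemma rapidly_increasing_add:
  fixes X Y :: "nat \<Rightarrow> 'a::precu"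
  shows "rapidly_increasing X \<Longrightarrow> rapidly_increasing Y \<Longrightarrow> rapidly_increasing (\<lambda>n. X n + Y n)"
  by (simp add: rapidly_increasing_def way_below_add)

lemma precu_map_monoD: "precu_map \<phi> \<Longrightarrow> x \<le> y \<Longrightarrow> \<phi> x \<le> \<phi> y"
  by (simp add: precu_map_def monoid_map_def monoD)

lemma precu_map_zero: "precu_map \<phi> \<Longrightarrow> \<phi> 0 = 0"
  by (simp add: precu_map_def monoid_map_def)

lemma precu_map_add: "precu_map \<phi> \<Longrightarrow> \<phi> (x + y) = \<phi> x + \<phi> y"
  by (simp add: precu_map_def monoid_map_def)

lemma precu_map_seq_sup:
  "precu_map \<phi> \<Longrightarrow> incseq X \<Longrightarrow> is_seq_sup X s \<Longrightarrow> is_seq_sup (\<lambda>n. \<phi> (X n)) (\<phi> s)"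
  by (simp add: precu_map_def)

lemma precu_map_way_below: "precu_map \<phi> \<Longrightarrow> x \<lless> y \<Longrightarrow> \<phi> x \<lless> \<phi> y"
  by (simp add: precu_map_def)

lemma precu_map_rapidly_increasing:
  "precu_map \<phi> \<Longrightarrow> rapidly_increasing X \<Longrightarrow> rapidly_increasing (\<lambda>n. \<phi> (X n))"
  by (simp add: precu_map_way_below rapidly_increasing_def)

lemma precu_map_incseq:
  "precu_map \<phi> \<Longrightarrow> rapidly_increasing X \<Longrightarrow> incseq (\<lambda>n. \<phi> (X n))"
  by (rule rapidly_increasing_imp_incseq) (rule precu_map_rapidly_increasing)

text \<open>One step further along the sequence suffices:
  \<open>X n \<lless> X (Suc n) \<le> s\<close>.\<close>

lemma rapidly_increasing_way_below_sup:
  fixes X :: "nat \<Rightarrow> 'a::order"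
  assumes "rapidly_increasing X" "is_seq_sup X s"
  shows "X n \<lless> s"
  using assms by (meson is_seq_sup_upper order_refl rapidly_increasing_def way_below_mono)

text \<open>Stated for a general pair of maps so that it serves twice: with
  \<open>\<phi> = \<iota>\<close> for monotonicity of the extension, and with
  \<open>\<phi> = \<alpha>\<close> for the embedding claim.\<close>

lemma seq_sup_comparison:
  fixes \<phi> :: "'m::precu \<Rightarrow> 'a::precu" and \<psi> :: "'m \<Rightarrow> 'b::precu"
  assumes "precu_map \<phi>" "order_embedding \<phi>" "precu_map \<psi>"
    and X: "rapidly_increasing X" "is_seq_sup (\<lambda>n. \<phi> (X n)) x" "is_seq_sup (\<lambda>n. \<psi> (X n)) p"
    and Y: "rapidly_increasing Y" "is_seq_sup (\<lambda>n. \<phi> (Y n)) y" "is_seq_sup (\<lambda>n. \<psi> (Y n)) q"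
    and "x \<le> y"
  shows "p \<le> q"
proof (rule is_seq_sup_least[OF X(3)])
  fix n
  have "\<phi> (X n) \<lless> x"
    using rapidly_increasing_way_below_sup precu_map_rapidly_increasing assms(1) X by blast
  then obtain k where "\<phi> (X n) \<le> \<phi> (Y k)"
    using way_belowD[OF _ precu_map_incseq[OF assms(1) Y(1)] Y(2) \<open>x \<le> y\<close>] by blast
  then have "X n \<le> Y k"
    using assms(2) by (simp add: order_embedding_def)
  then show "\<psi> (X n) \<le> q"
    using precu_map_monoD[OF assms(3)] is_seq_sup_upper[OF Y(3)] order_trans by blast
qed

text \<open>The graph of the extension, as a relation: each fact about \<open>\<beta>\<close> may
  then use whichever sequence suits it, without fixing one for every \<open>x\<close>.\<close>

definition extends_to :: "('m::precu \<Rightarrow> 'n::cu) \<Rightarrow> ('m \<Rightarrow> 'p::cu) \<Rightarrow> 'n \<Rightarrow> 'p \<Rightarrow> bool" where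
  "extends_to \<iota> \<alpha> x p \<longleftrightarrow> (\<exists>X. rapidly_increasing X \<and>
    is_seq_sup (\<lambda>n. \<iota> (X n)) x \<and> is_seq_sup (\<lambda>n. \<alpha> (X n)) p)"

context
  fixes \<alpha> :: "'m::precu \<Rightarrow> 'p::cu" and \<iota> :: "'m \<Rightarrow> 'n::cu"
  assumes alpha: "precu_map \<alpha>" and compl: "is_completion \<iota>"
begin

lemma precu_map_completion: "precu_map \<iota>" and order_embedding_completion: "order_embedding \<iota>"
  using compl by (auto simp: is_completion_def)

lemma completion_approx:
  obtains X where "rapidly_increasing X" "is_seq_sup (\<lambda>n. \<iota> (X n)) x"
  using compl by (auto simp: is_completion_def)

text \<open>The case \<open>x = y\<close>, taken in both directions, makes the relation
  single-valued.\<close>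

lemma extends_to_mono: "extends_to \<iota> \<alpha> x p \<Longrightarrow> extends_to \<iota> \<alpha> y q \<Longrightarrow> x \<le> y \<Longrightarrow> p \<le> q"
  unfolding extends_to_def
  using seq_sup_comparison[OF precu_map_completion order_embedding_completion alpha] by blast

lemma extends_to_exists: "\<exists>p. extends_to \<iota> \<alpha> x p"
proof -
  obtain X where "rapidly_increasing X" "is_seq_sup (\<lambda>n. \<iota> (X n)) x"
    by (rule completion_approx)
  \<comment> \<open>The supremum exists because \<open>P\<close> is an object of Cu.\<close>
  moreover from this obtain p where "is_seq_sup (\<lambda>n. \<alpha> (X n)) p"
    using incseq_has_sup precu_map_incseq[OF alpha] by blast
  ultimately show ?thesis
    by (auto simp: extends_to_def)
qed

text \<open>The termwise sum of the two witnessing sequences is a witness, by compatibility of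
  suprema and of \<open>\<lless>\<close> with addition.\<close>

lemma extends_to_add:
  assumes "extends_to \<iota> \<alpha> x p" "extends_to \<iota> \<alpha> y q"
  shows "extends_to \<iota> \<alpha> (x + y) (p + q)"
proof -
  from assms obtain X Y
    where X: "rapidly_increasing X" "is_seq_sup (\<lambda>n. \<iota> (X n)) x" "is_seq_sup (\<lambda>n. \<alpha> (X n)) p"
      and Y: "rapidly_increasing Y" "is_seq_sup (\<lambda>n. \<iota> (Y n)) y" "is_seq_sup (\<lambda>n. \<alpha> (Y n)) q"
    unfolding extends_to_def by blast
  have "is_seq_sup (\<lambda>n. \<iota> (X n + Y n)) (x + y)"
    unfolding precu_map_add[OF precu_map_completion]
    by (rule is_seq_sup_add) (fact precu_map_incseq[OF precu_map_completion X(1)] precu_map_incseq[OF precu_map_completion Y(1)] X(2) Y(2))+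
  moreover have "is_seq_sup (\<lambda>n. \<alpha> (X n + Y n)) (p + q)"
    unfolding precu_map_add[OF alpha]
    by (rule is_seq_sup_add) (fact precu_map_incseq[OF alpha X(1)] precu_map_incseq[OF alpha Y(1)] X(3) Y(3))+
  ultimately show ?thesis
    unfolding extends_to_def using rapidly_increasing_add[OF X(1) Y(1)] by blast
qed

text \<open>A rapidly increasing sequence in \<open>M\<close> with supremum \<open>m\<close> is a
  witness, since both maps preserve its supremum.\<close>

lemma extends_to_completion: "extends_to \<iota> \<alpha> (\<iota> m) (\<alpha> m)"
  unfolding extends_to_def
  using rapidly_increasing_approx[of m] precu_map_seq_sup[OF alpha]
    precu_map_seq_sup[OF precu_map_completion] rapidly_increasing_imp_incseq by blast

text \<open>The terms of \<open>Z\<close> may lie outside the image of \<open>\<iota>\<close>. If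
  \<open>X\<close> witnesses the value at \<open>z\<close>, each \<open>\<iota> (X n)\<close> is way
  below \<open>z\<close> and so below some \<open>Z k\<close>; thus a bound of all
  \<open>\<beta> (Z k)\<close> bounds all \<open>\<alpha> (X n)\<close>.\<close>

lemma extends_to_seq_sup:
  assumes ext: "\<And>x. extends_to \<iota> \<alpha> x (\<beta> x)"
    and "incseq Z" "is_seq_sup Z z"
  shows "is_seq_sup (\<lambda>n. \<beta> (Z n)) (\<beta> z)"
  unfolding is_seq_sup_def
proof (intro conjI allI impI)
  show "\<beta> (Z n) \<le> \<beta> z" for n
    using extends_to_mono ext is_seq_sup_upper[OF assms(3)] by blast
next
  fix u assume u: "\<forall>n. \<beta> (Z n) \<le> u"
  obtain X where X: "rapidly_increasing X" "is_seq_sup (\<lambda>n. \<iota> (X n)) z" "is_seq_sup (\<lambda>n. \<alpha> (X n)) (\<beta> z)"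
    using ext[of z] by (auto simp: extends_to_def)
  show "\<beta> z \<le> u"
  proof (rule is_seq_sup_least[OF X(3)])
    fix n
    have "\<iota> (X n) \<lless> z"
      using rapidly_increasing_way_below_sup
        precu_map_rapidly_increasing[OF precu_map_completion] X by blast
    then obtain k where "\<iota> (X n) \<le> Z k"
      using way_belowD assms(2,3) by blast
    then have "\<alpha> (X n) \<le> \<beta> (Z k)"
      using extends_to_mono extends_to_completion ext by blast
    then show "\<alpha> (X n) \<le> u"
      using u order_trans by blast
  qed
qed

text \<open>An element of \<open>M\<close> is interpolated: \<open>x \<le> \<iota> (Y k)\<close> for
  some \<open>k\<close>, whence \<open>p \<le> \<alpha> (Y k) \<lless> q\<close>.\<close>

lemma extends_to_way_below:
  assumes "extends_to \<iota> \<alpha> x p" "extends_to \<iota> \<alpha> y q" "x \<lless> y"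
  shows "p \<lless> q"
proof -
  obtain Y where Y: "rapidly_increasing Y" "is_seq_sup (\<lambda>n. \<iota> (Y n)) y" "is_seq_sup (\<lambda>n. \<alpha> (Y n)) q"
    using assms(2) by (auto simp: extends_to_def)
  obtain k where "x \<le> \<iota> (Y k)"
    using way_belowD[OF assms(3) precu_map_incseq[OF precu_map_completion Y(1)] Y(2)] by blast
  then have "p \<le> \<alpha> (Y k)"
    using extends_to_mono extends_to_completion assms(1) by blast
  moreover have "\<alpha> (Y k) \<lless> q"
    using rapidly_increasing_way_below_sup precu_map_rapidly_increasing[OF alpha] Y by blast
  ultimately show ?thesis
    using way_below_mono by blast
qed

lemma precu_map_extension:
  assumes ext: "\<And>x. extends_to \<iota> \<alpha> x (\<beta> x)"
  shows "precu_map \<beta>" "\<beta> \<circ> \<iota> = \<alpha>"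
proof -
  have unique: "\<beta> x = p" if "extends_to \<iota> \<alpha> x p" for x p
    using extends_to_mono ext that by (meson antisym order_refl)
  have on_completion: "\<beta> (\<iota> m) = \<alpha> m" for m
    using unique extends_to_completion by blast
  then show "\<beta> \<circ> \<iota> = \<alpha>"
    by auto
  have "\<beta> 0 = 0"
    using on_completion[of 0] precu_map_zero[OF alpha] precu_map_zero[OF precu_map_completion] by simp
  moreover have "\<beta> (x + y) = \<beta> x + \<beta> y" for x y
    using unique extends_to_add ext by blast
  moreover have "mono \<beta>"
    using extends_to_mono ext by (blast intro: monoI)
  ultimately show "precu_map \<beta>"
    unfolding precu_map_def monoid_map_def
    using extends_to_seq_sup[OF ext] extends_to_way_below ext by blast
qed

text \<open>This yields uniqueness, as the relation is single-valued. It also supplies one sequence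
  computing both \<open>x\<close> and \<open>\<beta> x\<close>, as the embedding claim
  requires.\<close>

lemma extends_to_precu_map:
  assumes "precu_map \<beta>" "\<beta> \<circ> \<iota> = \<alpha>"
  shows "extends_to \<iota> \<alpha> x (\<beta> x)"
proof -
  obtain X where X: "rapidly_increasing X" "is_seq_sup (\<lambda>n. \<iota> (X n)) x"
    by (rule completion_approx)
  have "is_seq_sup (\<lambda>n. \<alpha> (X n)) (\<beta> x)"
    using precu_map_seq_sup[OF assms(1) precu_map_incseq[OF precu_map_completion X(1)] X(2)] assms(2)
    by auto
  with X show ?thesis
    by (auto simp: extends_to_def)
qed

lemma order_embedding_extension:
  assumes "precu_map \<beta>" "\<beta> \<circ> \<iota> = \<alpha>" "order_embedding \<alpha>"
  shows "order_embedding \<beta>"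
proof -
  have "x \<le> y" if "\<beta> x \<le> \<beta> y" for x y
    \<comment> \<open>Here the hypothesis compares suprema of \<open>\<alpha>\<close>-images, and
      the conclusion those of \<open>\<iota>\<close>-images.\<close>
    using extends_to_precu_map[OF assms(1,2), of x] extends_to_precu_map[OF assms(1,2), of y]
      seq_sup_comparison[OF alpha assms(3) precu_map_completion] that
    unfolding extends_to_def by blast
  then show ?thesis
    using assms(1) by (simp add: order_embedding_def precu_map_def)
qed

end

theorem theorem3p3:
  fixes \<alpha> :: "'m::precu \<Rightarrow> 'p::cu" and \<iota> :: "'m \<Rightarrow> 'n::cu"
  assumes "precu_map \<alpha>" and "is_completion \<iota>"
  shows "(\<exists>!\<beta> :: 'n \<Rightarrow> 'p. precu_map \<beta> \<and> \<beta> \<circ> \<iota> = \<alpha>) \<and>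
    (\<forall>\<beta> :: 'n \<Rightarrow> 'p. precu_map \<beta> \<longrightarrow> \<beta> \<circ> \<iota> = \<alpha> \<longrightarrow> order_embedding \<alpha> \<longrightarrow> order_embedding \<beta>)"
proof (intro conjI allI impI)
  \<comment> \<open>Totality of the relation gives \<open>\<beta>\<close> by choice.\<close>
  obtain \<beta> where "\<And>x. extends_to \<iota> \<alpha> x (\<beta> x)"
    using extends_to_exists[OF assms] by metis
  then have \<beta>: "precu_map \<beta>" "\<beta> \<circ> \<iota> = \<alpha>"
    using precu_map_extension[OF assms] by blast+
  show "\<exists>!\<beta>. precu_map \<beta> \<and> \<beta> \<circ> \<iota> = \<alpha>"
  proof (rule ex1I[of _ \<beta>])
    fix \<gamma> :: "'n \<Rightarrow> 'p" assume \<gamma>: "precu_map \<gamma> \<and> \<gamma> \<circ> \<iota> = \<alpha>"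
    show "\<gamma> = \<beta>"
    proof
      fix x
      have "extends_to \<iota> \<alpha> x (\<beta> x)" "extends_to \<iota> \<alpha> x (\<gamma> x)"
        using extends_to_precu_map[OF assms] \<beta> \<gamma> by blast+
      then show "\<gamma> x = \<beta> x"
        using extends_to_mono[OF assms] by (meson antisym order_refl)
    qed
  qed (use \<beta> in blast)
qed (use order_embedding_extension[OF assms] in blast)

end
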